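(* Let $\psi_{*}\in\Psi$ and let $R(\psi_{*})=\{x\in\mathcal{X}:RB_{\Psi}(\psi_{*}\,|\,x)\leq 1\}$. (i) Among all measurable sets $D(\psi_{*})\subset\mathcal{X}$ satisfying $$M(D(\psi_{*})\,|\,\psi_{*})\leq M(R(\psi_{*})\,|\,\psi_{*}),$$ the prior probability $M(D(\psi_{*}))$ is maximized by $D(\psi_{*})=R(\psi_{*})$. (ii) For measurable $D(\psi_{*})\subset\mathcal{X}$, consider the prior probability of not obtaining evidence in favor of $\psi_{*}$ when it is false, $$\int_{\Psi\backslash\{\psi_{*}\}}M(D(\psi_{*})\,|\,\psi)\,\Pi_{\Psi}(d\psi).$$ If $\Pi_{\Psi}(\{\psi_{*}\})=0$, then $D(\psi_{*})=R(\psi_{*})$ maximizes this quantity among all measurable $D(\psi_{*})$ satisfying $M(D(\psi_{*})\,|\,\psi_{*})\leq M(R(\psi_{*})\,|\,\psi_{*})$. If $\Pi_{\Psi}(\{\psi_{*}\})\neq 0$, then $D(\psi_{*})=R(\psi_{*})$ maximizes this quantity among all measurable $D(\psi_{*})$ satisfying $M(D(\psi_{*})\,|\,\psi_{*})= M(R(\psi_{*})\,|\,\psi_{*})$.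
   Context: Setting. $\{f_{\theta}:\theta\in\Theta\}$ is a statistical model of probability densities for data $x\in\mathcal{X}$ with respect to a common $\sigma$-finite support measure $\mu$ on $\mathcal{X}$, with $f_\theta(x)$ jointly measurable. $\Pi$ is a proper prior (a probability measure) on $\Theta$. $\Psi:\Theta\rightarrow\Psi$ is a measurable map that is onto (the same symbol denotes the map and its range), and $\psi=\Psi(\theta)$ is the quantity of interest. $\Pi_{\Psi}$ is the marginal prior of $\psi$ (singletons are measurable), and $\Pi(\cdot\,|\,\psi)$ is the conditional prior of $\theta$ given $\Psi(\theta)=\psi$, a regular conditional probability. Prior predictives. $m(x)=\int_{\Theta}f_{\theta}(x)\,\Pi(d\theta)$ is the prior predictive density and $M(B)=\int_{B}m(x)\,\mu(dx)$. The conditional prior predictive density given $\psi$ is $m(x\,|\,\psi)=\int_{\Theta}f_{\theta}(x)\,\Pi(d\theta\,|\,\psi)$, and $M(B\,|\,\psi)=\int_{B}m(x\,|\,\psi)\,\mu(dx)$. Thus $M(B)=\int_{\Psi}M(B\,|\,\psi)\,\Pi_{\Psi}(d\psi)$. Relative belief ratio. $RB_{\Psi}(\psi\,|\,x)$ is the ratio of the posterior density to the prior density of $\psi$, which equals $m(x\,|\,\psi)/m(x)$. The conditions $RB_{\Psi}(\psi\,|\,x)\le 1$, $<1$, $\ge 1$, $>1$ mean respectively $m(x\,|\,\psi)\le m(x)$, $<$, $\ge$, $>$. Principle of evidence: there is evidence in favor of $\psi$ when $RB_{\Psi}(\psi\,|\,x)>1$ and evidence against $\psi$ when $RB_{\Psi}(\psi\,|\,x)<1$.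 The set $D(\psi_{*})$ is the set of data values that, under some arbitrary evidence rule, do not give evidence in favor of $\psi_{*}$. The set $R(\psi_{*})$ plays this role for the principle of evidence. *)

theory Defs
  imports "HOL-Probability.Probability"
begin

text \<open>
  \<open>\<Theta>\<close> with its \<open>\<sigma>\<close>-algebra is the measurable space underlying the measure \<open>prior\<close>; the range of
  \<open>\<Psi>\<close> with its \<open>\<sigma>\<close>-algebra is the measurable space underlying \<open>S\<close>, and only \<open>sets S\<close> matters.
  The kernel \<open>K\<close> is the regular conditional probability of \<open>\<theta>\<close> given \<open>\<Psi> \<theta> = \<psi>\<close>; any version
  of it is allowed.
\<close>

locale bayes_model = sigma_finite_measure \<mu> + prior: prob_space prior
  for \<mu> :: "'x measure" and f :: "'t \<Rightarrow> 'x \<Rightarrow> real" and prior :: "'t measure"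
    and S :: "'p measure" and \<Psi> :: "'t \<Rightarrow> 'p" and K :: "'p \<Rightarrow> 't measure" +
  assumes f_measurable: "(\<lambda>(\<theta>, x). f \<theta> x) \<in> borel_measurable (prior \<Otimes>\<^sub>M \<mu>)"
    and f_nonneg: "\<And>\<theta> x. \<theta> \<in> space prior \<Longrightarrow> x \<in> space \<mu> \<Longrightarrow> 0 \<le> f \<theta> x"
    and f_density: "\<And>\<theta>. \<theta> \<in> space prior \<Longrightarrow> (\<integral>\<^sup>+x. ennreal (f \<theta> x) \<partial>\<mu>) = 1"
    and Psi_measurable: "\<Psi> \<in> measurable prior S"
    and Psi_onto: "\<Psi> ` space prior = space S"
    and singletons: "\<And>\<psi>. \<psi> \<in> space S \<Longrightarrow> {\<psi>} \<in> sets S"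
    and K_kernel: "K \<in> measurable S (prob_algebra prior)"
    and K_disintegration: "\<And>A B. A \<in> sets prior \<Longrightarrow> B \<in> sets S \<Longrightarrow>
      emeasure prior (A \<inter> \<Psi> -` B) = (\<integral>\<^sup>+\<psi>\<in>B. emeasure (K \<psi>) A \<partial>distr prior S \<Psi>)"

text \<open>
  For \<open>Q = prior\<close> the next two definitions are \<open>m(x)\<close> and \<open>M(B)\<close>; for \<open>Q = K \<psi>\<close> they are
  \<open>m(x | \<psi>)\<close> and \<open>M(B | \<psi>)\<close>. The density may be infinite on a \<open>\<mu>\<close>-null set of \<open>x\<close>.
\<close>

definition predictive_density :: "('t \<Rightarrow> 'x \<Rightarrow> real) \<Rightarrow> 't measure \<Rightarrow> 'x \<Rightarrow> ennreal" where
  "predictive_density f Q x = (\<integral>\<^sup>+\<theta>. ennreal (f \<theta> x) \<partial>Q)"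

definition predictive ::
    "'x measure \<Rightarrow> ('t \<Rightarrow> 'x \<Rightarrow> real) \<Rightarrow> 't measure \<Rightarrow> 'x set \<Rightarrow> ennreal" where
  "predictive \<mu> f Q B = (\<integral>\<^sup>+x\<in>B. predictive_density f Q x \<partial>\<mu>)"

text \<open>
  The posterior density of \<open>\<psi>\<close> relative to its prior is determined only up to null sets;
  \<open>m(x | \<psi>) / m(x)\<close> is the version used (see \<open>marginal_posterior_eq\<close> below). Division is in
  \<open>ennreal\<close>, where \<open>0 / 0 = \<infinity> / \<infinity> = 0\<close> and \<open>c / 0 = \<infinity>\<close> for \<open>c > 0\<close>, so the condition
  \<open>\<le> 1\<close> agrees with \<open>m(x | \<psi>) \<le> m(x)\<close> for every \<open>x\<close>. (The
  conditions \<open>< 1\<close> and \<open>\<ge> 1\<close> do not match \<open>m(x | \<psi>) < m(x)\<close> and \<open>m(x | \<psi>) \<ge> m(x)\<close>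
  when \<open>m(x | \<psi>) = m(x) \<in> {0, \<infinity>}\<close>.)
\<close>

definition relative_belief ::
    "('t \<Rightarrow> 'x \<Rightarrow> real) \<Rightarrow> 't measure \<Rightarrow> ('p \<Rightarrow> 't measure) \<Rightarrow> 'p \<Rightarrow> 'x \<Rightarrow> ennreal" where
  "relative_belief f prior K \<psi> x = predictive_density f (K \<psi>) x / predictive_density f prior x"

definition no_evidence_set ::
    "'x measure \<Rightarrow> ('t \<Rightarrow> 'x \<Rightarrow> real) \<Rightarrow> 't measure \<Rightarrow> ('p \<Rightarrow> 't measure) \<Rightarrow> 'p \<Rightarrow> 'x set" where
  "no_evidence_set \<mu> f prior K \<psi> = {x \<in> space \<mu>. relative_belief f prior K \<psi> x \<le> 1}"

definition prob_no_evidence_false ::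
    "'x measure \<Rightarrow> ('t \<Rightarrow> 'x \<Rightarrow> real) \<Rightarrow> 't measure \<Rightarrow> 'p measure \<Rightarrow> ('t \<Rightarrow> 'p) \<Rightarrow>
     ('p \<Rightarrow> 't measure) \<Rightarrow> 'p \<Rightarrow> 'x set \<Rightarrow> ennreal" where
  "prob_no_evidence_false \<mu> f prior S \<Psi> K \<psi>\<^sub>0 D =
     (\<integral>\<^sup>+\<psi>\<in>space S - {\<psi>\<^sub>0}. predictive \<mu> f (K \<psi>) D \<partial>distr prior S \<Psi>)"

lemma relative_belief_le_1_iff:
  "relative_belief f prior K \<psi> x \<le> 1 \<longleftrightarrow>
     predictive_density f (K \<psi>) x \<le> predictive_density f prior x"
proof -
  have "a / b \<le> 1 \<longleftrightarrow> a \<le> b" for a b :: ennreal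
  proof (cases "b = 0 \<or> b = \<top>")
    case True
    then show ?thesis
      by (cases "a = 0") (auto simp: ennreal_divide_zero ennreal_divide_top ennreal_divide_eq_top_iff top_unique)
  next
    case False
    then have b: "0 < b" "b < \<top>" by (auto simp: zero_less_iff_neq_zero less_top)
    have "a \<le> b" if "a / b \<le> 1"
      using mult_right_mono[OF that, of b] b by (simp add: ennreal_divide_times ennreal_mult_divide_eq)
    moreover have "a / b \<le> 1" if "a \<le> b"
      using that b by (intro divide_le_posI_ennreal) auto
    ultimately show ?thesis by blast
  qed
  then show ?thesis by (simp add: relative_belief_def)
qed

context bayes_model
begin

lemma marginal_posterior_eq:
  assumes x: "x \<in> space \<mu>" and pos: "0 < predictive_density f prior x"
    and fin: "predictive_density f prior x < \<infinity>"
  shows "distr (density prior (\<lambda>\<theta>. ennreal (f \<theta> x) / predictive_density f prior x)) S \<Psi> =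
         density (distr prior S \<Psi>) (\<lambda>\<psi>. relative_belief f prior K \<psi> x)"
proof -
  let ?m = "predictive_density f prior x"
  let ?P = "distr prior S \<Psi>"
  note [measurable] = f_measurable Psi_measurable
  have fx[measurable]: "(\<lambda>\<theta>. f \<theta> x) \<in> borel_measurable prior"
    using x by measurable
  have K[measurable]: "K \<in> measurable S (subprob_algebra prior)"
    using K_kernel by (rule measurable_prob_algebraD)
  have mK[measurable]: "(\<lambda>\<psi>. predictive_density f (K \<psi>) x) \<in> borel_measurable S"
    unfolding predictive_density_def
    by (rule measurable_compose[OF K nn_integral_measurable_subprob_algebra]) simp
  have Sne: "space S \<noteq> {}"
    using Psi_onto prior.not_empty by auto
  have key: "(\<integral>\<^sup>+\<theta>\<in>\<Psi> -` B \<inter> space prior. ennreal (f \<theta> x) \<partial>prior) =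
      (\<integral>\<^sup>+\<psi>\<in>B. predictive_density f (K \<psi>) x \<partial>?P)" if B[measurable]: "B \<in> sets S" for B
  proof -
    let ?N = "density ?P (indicator B)"
    have eq: "density prior (indicator (\<Psi> -` B \<inter> space prior)) = bind ?N K"
    proof (rule measure_eqI)
      have s: "sets (bind ?N K) = sets prior"
        using Sne by (intro sets_bind) (auto simp: sets_kernel[OF K])
      then show "sets (density prior (indicator (\<Psi> -` B \<inter> space prior))) = sets (bind ?N K)"
        by simp
      fix A assume "A \<in> sets (density prior (indicator (\<Psi> -` B \<inter> space prior)))"
      then have A[measurable]: "A \<in> sets prior" by simp
      have "emeasure (density prior (indicator (\<Psi> -` B \<inter> space prior))) A =
          (\<integral>\<^sup>+\<theta>. indicator (A \<inter> \<Psi> -` B) \<theta> \<partial>prior)"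
        by (subst emeasure_density) (auto intro!: nn_integral_cong simp: indicator_def)
      also have "\<dots> = emeasure prior (A \<inter> \<Psi> -` B)"
      proof (rule nn_integral_indicator)
        have "A \<inter> \<Psi> -` B = A \<inter> (\<Psi> -` B \<inter> space prior)"
          using sets.sets_into_space[OF A] by auto
        then show "A \<inter> \<Psi> -` B \<in> sets prior" by simp
      qed
      also have "\<dots> = (\<integral>\<^sup>+\<psi>\<in>B. emeasure (K \<psi>) A \<partial>?P)"
        by (rule K_disintegration) fact+
      also have "\<dots> = (\<integral>\<^sup>+\<psi>. emeasure (K \<psi>) A \<partial>?N)"
        by (subst nn_integral_density)
           (auto intro!: nn_integral_cong measurable_emeasure_kernel[OF K] simp: mult.commute)
      also have "\<dots> = emeasure (bind ?N K) A"
        using Sne by (subst emeasure_bind[where N = prior]) auto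
      finally show "emeasure (density prior (indicator (\<Psi> -` B \<inter> space prior))) A =
        emeasure (bind ?N K) A" .
    qed
    have "(\<integral>\<^sup>+\<theta>\<in>\<Psi> -` B \<inter> space prior. ennreal (f \<theta> x) \<partial>prior) =
        (\<integral>\<^sup>+\<theta>. ennreal (f \<theta> x) \<partial>density prior (indicator (\<Psi> -` B \<inter> space prior)))"
      by (subst nn_integral_density) (auto simp: mult.commute)
    also have "\<dots> = (\<integral>\<^sup>+\<psi>. predictive_density f (K \<psi>) x \<partial>?N)"
      unfolding eq predictive_density_def
      by (rule nn_integral_bind[where B = prior]) auto
    also have "\<dots> = (\<integral>\<^sup>+\<psi>\<in>B. predictive_density f (K \<psi>) x \<partial>?P)"
      by (subst nn_integral_density) (auto simp: mult.commute)
    finally show ?thesis .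
  qed
  show ?thesis
  proof (rule measure_eqI)
    fix B assume "B \<in> sets (distr (density prior (\<lambda>\<theta>. ennreal (f \<theta> x) / ?m)) S \<Psi>)"
    then have B[measurable]: "B \<in> sets S" by simp
    have "emeasure (distr (density prior (\<lambda>\<theta>. ennreal (f \<theta> x) / ?m)) S \<Psi>) B =
        (\<integral>\<^sup>+\<theta>. (ennreal (f \<theta> x) * indicator (\<Psi> -` B \<inter> space prior) \<theta>) / ?m \<partial>prior)"
      by (subst emeasure_distr)
         (auto simp: emeasure_density ennreal_divide_times divide_ennreal_def mult_ac
               intro!: nn_integral_cong)
    also have "\<dots> = (\<integral>\<^sup>+\<theta>\<in>\<Psi> -` B \<inter> space prior. ennreal (f \<theta> x) \<partial>prior) / ?m"
      by (rule nn_integral_divide) simp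
    also have "\<dots> = (\<integral>\<^sup>+\<psi>. (predictive_density f (K \<psi>) x * indicator B \<psi>) / ?m \<partial>?P)"
      unfolding key[OF B] by (rule nn_integral_divide[symmetric]) simp
    also have "\<dots> = emeasure (density ?P (\<lambda>\<psi>. relative_belief f prior K \<psi> x)) B"
      by (subst emeasure_density)
         (auto simp: relative_belief_def divide_ennreal_def mult_ac intro!: nn_integral_cong)
    finally show "emeasure (distr (density prior (\<lambda>\<theta>. ennreal (f \<theta> x) / ?m)) S \<Psi>) B =
      emeasure (density ?P (\<lambda>\<psi>. relative_belief f prior K \<psi> x)) B" .
  qed simp
qed

end

end

theory Submission
  imports Defs
begin

text \<open>
  Part (i) is the Neyman--Pearson argument with threshold 1: the conditional density dominates
  the unconditional one exactly off \<open>R\<close>, so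
  \<open>M(D - R) \<le> M(D - R | \<psi>\<^sub>0) \<le> M(R - D | \<psi>\<^sub>0) \<le> M(R - D)\<close>.
  Part (ii) reduces to (i), because \<open>M(D)\<close> is the quantity in (ii) plus
  \<open>M(D | \<psi>\<^sub>0) \<Pi>\<^sub>\<Psi>({\<psi>\<^sub>0})\<close>, and this second term is finite and, in both cases, the same for
  \<open>D\<close> and \<open>R\<close>.
\<close>

text \<open>Regarding both integrals as measures \<open>P\<close> and \<open>Q\<close> reduces the
  claim to additivity: \<open>D\<close> and \<open>R\<close> share \<open>D \<inter> R\<close>, so
  only \<open>D - R\<close> and \<open>R - D\<close> need comparing. Only \<open>p\<close> has to be
  integrable over \<open>D\<close>; the integrals of \<open>q\<close> may be infinite.\<close>

lemma neyman_pearson_threshold_one: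
  fixes p q :: "'a \<Rightarrow> ennreal"
  assumes [measurable]: "p \<in> borel_measurable M" "q \<in> borel_measurable M" "D \<in> sets M"
    and R: "R = {x \<in> space M. p x \<le> q x}"
    and fin: "(\<integral>\<^sup>+x\<in>D. p x \<partial>M) < \<infinity>"
    and le: "(\<integral>\<^sup>+x\<in>D. p x \<partial>M) \<le> (\<integral>\<^sup>+x\<in>R. p x \<partial>M)"
  shows "(\<integral>\<^sup>+x\<in>D. q x \<partial>M) \<le> (\<integral>\<^sup>+x\<in>R. q x \<partial>M)"
proof -
  have [measurable]: "R \<in> sets M" unfolding R by measurable
  define P where "P = density M p"
  define Q where "Q = density M q"
  have P_eq: "emeasure P A = (\<integral>\<^sup>+x\<in>A. p x \<partial>M)" and Q_eq: "emeasure Q A = (\<integral>\<^sup>+x\<in>A. q x \<partial>M)"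
    if "A \<in> sets M" for A
    using that by (auto simp: P_def Q_def emeasure_density)
  have split: "emeasure N A = emeasure N (A \<inter> B) + emeasure N (A - B)"
    if "sets N = sets M" "A \<in> sets M" "B \<in> sets M" for N A B
    using that by (subst plus_emeasure) (auto intro!: arg_cong[where f = "emeasure N"])
  have [simp]: "sets P = sets M" "sets Q = sets M" by (auto simp: P_def Q_def)
  \<comment> \<open>In \<open>ennreal\<close> a common summand cancels only if it is finite; this
    bound allows \<open>P (D \<inter> R)\<close> to be removed from both sides of
    \<open>le\<close>.\<close>
  have fin_inter: "emeasure P (D \<inter> R) < \<infinity>"
    using fin emeasure_mono[of "D \<inter> R" D P] by (auto simp: P_eq[symmetric])
  have "emeasure P (D \<inter> R) + emeasure P (D - R) \<le> emeasure P (D \<inter> R) + emeasure P (R - D)"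
    using le split[of P D R] split[of P R D] by (simp add: P_eq[symmetric] Int_commute)
  then have P_le: "emeasure P (D - R) \<le> emeasure P (R - D)"
    using fin_inter by (auto simp: ennreal_add_left_cancel_le)
  have "emeasure Q (D - R) \<le> emeasure P (D - R)"
    using sets.sets_into_space[of D M]
    by (auto simp: P_eq Q_eq R indicator_def intro!: nn_integral_mono)
  also note P_le
  also have "emeasure P (R - D) \<le> emeasure Q (R - D)"
    by (auto simp: P_eq Q_eq R indicator_def intro!: nn_integral_mono)
  \<comment> \<open>On the \<open>Q\<close> side the common part is added back, which is monotone
    and so calls for no finiteness.\<close>
  finally have "emeasure Q D \<le> emeasure Q R"
    using split[of Q D R] split[of Q R D] by (simp add: Int_commute add_left_mono)
  then show ?thesis by (simp add: Q_eq)
qed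

context bayes_model
begin

lemma kernel_prob_space: "\<psi> \<in> space S \<Longrightarrow> prob_space (K \<psi>)"
  and kernel_sets: "\<psi> \<in> space S \<Longrightarrow> sets (K \<psi>) = sets prior"
  using measurable_space[OF K_kernel] by (auto simp: space_prob_algebra)

text \<open>Tonelli for a general mixing measure \<open>Q\<close>, so that one result serves both
  \<open>prior\<close> and every \<open>K \<psi>\<close>. Equality of the sigma-algebras transfers
  joint measurability of \<open>f\<close> to \<open>Q\<close>, and the bound 1 comes from each
  \<open>f \<theta>\<close> being a probability density.\<close>

lemma
  assumes "prob_space Q" and sets_Q: "sets Q = sets prior"
  shows predictive_density_measurable: "predictive_density f Q \<in> borel_measurable \<mu>"
    and predictive_eq_iterated: "D \<in> sets \<mu> \<Longrightarrow>
      predictive \<mu> f Q D = (\<integral>\<^sup>+\<theta>. (\<integral>\<^sup>+x\<in>D. ennreal (f \<theta> x) \<partial>\<mu>) \<partial>Q)"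
    and predictive_le_1: "D \<in> sets \<mu> \<Longrightarrow> predictive \<mu> f Q D \<le> 1"
proof -
  interpret Q: prob_space Q by fact
  interpret pair_sigma_finite Q \<mu> by unfold_locales
  have f_Q[measurable]: "(\<lambda>(\<theta>, x). f \<theta> x) \<in> borel_measurable (Q \<Otimes>\<^sub>M \<mu>)"
    using f_measurable by (simp cong: measurable_cong_sets sets_pair_measure_cong add: sets_Q)
  have "(\<lambda>x. \<integral>\<^sup>+\<theta>. ennreal (f \<theta> x) \<partial>Q) \<in> borel_measurable \<mu>"
    by measurable
  then show "predictive_density f Q \<in> borel_measurable \<mu>"
    by (simp add: predictive_density_def[abs_def])
  assume D[measurable]: "D \<in> sets \<mu>"
  have "predictive \<mu> f Q D = (\<integral>\<^sup>+x. (\<integral>\<^sup>+\<theta>. ennreal (f \<theta> x) * indicator D x \<partial>Q) \<partial>\<mu>)"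
    unfolding predictive_def predictive_density_def
    by (intro nn_integral_cong nn_integral_multc[symmetric]) measurable
  also have "\<dots> = (\<integral>\<^sup>+\<theta>. (\<integral>\<^sup>+x\<in>D. ennreal (f \<theta> x) \<partial>\<mu>) \<partial>Q)"
    by (rule Fubini') measurable
  finally show eq: "predictive \<mu> f Q D = (\<integral>\<^sup>+\<theta>. (\<integral>\<^sup>+x\<in>D. ennreal (f \<theta> x) \<partial>\<mu>) \<partial>Q)" .
  have "\<dots> \<le> (\<integral>\<^sup>+\<theta>. 1 \<partial>Q)"
  proof (rule nn_integral_mono)
    fix \<theta> assume "\<theta> \<in> space Q"
    then have \<theta>: "\<theta> \<in> space prior" using sets_eq_imp_space_eq[OF sets_Q] by simp
    have "(\<integral>\<^sup>+x\<in>D. ennreal (f \<theta> x) \<partial>\<mu>) \<le> (\<integral>\<^sup>+x. ennreal (f \<theta> x) \<partial>\<mu>)"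
      by (intro nn_integral_mono) (simp add: indicator_def)
    then show "(\<integral>\<^sup>+x\<in>D. ennreal (f \<theta> x) \<partial>\<mu>) \<le> 1" by (simp add: f_density[OF \<theta>])
  qed
  then show "predictive \<mu> f Q D \<le> 1" by (simp add: eq Q.emeasure_space_1)
qed

text \<open>This is the disintegration with \<open>B = space S\<close>. In this form
  \<open>nn_integral_bind\<close> turns integrals over the prior into iterated ones.\<close>

lemma prior_eq_bind: "prior = distr prior S \<Psi> \<bind> K"
proof -
  have K: "K \<in> measurable S (subprob_algebra prior)"
    using K_kernel by (rule measurable_prob_algebraD)
  have ne: "space S \<noteq> {}"
    using Psi_onto prior.not_empty by auto
  show ?thesis
  proof (rule measure_eqI)
    show "sets prior = sets (distr prior S \<Psi> \<bind> K)"
      using ne sets_kernel[OF K] by (intro sets_bind[symmetric]) auto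
    fix A assume A: "A \<in> sets prior"
    have "A \<inter> \<Psi> -` space S = A"
      using sets.sets_into_space[OF A] measurable_space[OF Psi_measurable] by auto
    then have "emeasure prior A = (\<integral>\<^sup>+\<psi>\<in>space S. emeasure (K \<psi>) A \<partial>distr prior S \<Psi>)"
      using K_disintegration[OF A, of "space S"] by simp
    also have "\<dots> = (\<integral>\<^sup>+\<psi>. emeasure (K \<psi>) A \<partial>distr prior S \<Psi>)"
      by (intro nn_integral_cong) simp
    also have "\<dots> = emeasure (distr prior S \<Psi> \<bind> K) A"
      using ne K A by (subst emeasure_bind[where N = prior]) auto
    finally show "emeasure prior A = emeasure (distr prior S \<Psi> \<bind> K) A" .
  qed
qed

text \<open>Total probability over \<psi>, with the point \<open>\<psi>\<^sub>0\<close> split off.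
  The iterated form of \<open>predictive\<close> has the integral over \<theta> outermost, where the
  mixture representation of the prior applies.\<close>

lemma predictive_decompose:
  assumes [measurable]: "D \<in> sets \<mu>" and \<psi>\<^sub>0: "\<psi>\<^sub>0 \<in> space S"
  shows "predictive \<mu> f prior D = prob_no_evidence_false \<mu> f prior S \<Psi> K \<psi>\<^sub>0 D +
    predictive \<mu> f (K \<psi>\<^sub>0) D * emeasure (distr prior S \<Psi>) {\<psi>\<^sub>0}"
proof -
  note [measurable] = f_measurable singletons[OF \<psi>\<^sub>0]
  let ?P = "distr prior S \<Psi>"
  let ?g = "\<lambda>\<theta>. \<integral>\<^sup>+x\<in>D. ennreal (f \<theta> x) \<partial>\<mu>"
  have K[measurable]: "K \<in> measurable S (subprob_algebra prior)"
    using K_kernel by (rule measurable_prob_algebraD)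
  have g[measurable]: "?g \<in> borel_measurable prior" by measurable
  have eq: "(\<integral>\<^sup>+\<theta>. ?g \<theta> \<partial>K \<psi>) = predictive \<mu> f (K \<psi>) D" if "\<psi> \<in> space S" for \<psi>
    using that by (simp add: predictive_eq_iterated kernel_prob_space kernel_sets)
  \<comment> \<open>Measurability in \<psi> is read off the iterated form, since there a fixed
    function \<open>?g\<close> is integrated against the kernel.\<close>
  have "(\<lambda>\<psi>. \<integral>\<^sup>+\<theta>. ?g \<theta> \<partial>K \<psi>) \<in> borel_measurable S"
    by (rule measurable_compose[OF K nn_integral_measurable_subprob_algebra]) (rule g)
  then have [measurable]: "(\<lambda>\<psi>. predictive \<mu> f (K \<psi>) D) \<in> borel_measurable S"
    by (subst (asm) measurable_cong[OF eq])
  have "predictive \<mu> f prior D = (\<integral>\<^sup>+\<theta>. ?g \<theta> \<partial>prior)"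
    by (simp add: predictive_eq_iterated prior.prob_space_axioms)
  also have "\<dots> = (\<integral>\<^sup>+\<theta>. ?g \<theta> \<partial>(?P \<bind> K))"
    using prior_eq_bind by simp
  also have "\<dots> = (\<integral>\<^sup>+\<psi>. (\<integral>\<^sup>+\<theta>. ?g \<theta> \<partial>K \<psi>) \<partial>?P)"
    by (rule nn_integral_bind[where B = prior]) auto
  \<comment> \<open>Exactly one indicator is 1 at each point of \<open>space S\<close>. Writing
    \<open>\<psi>\<^sub>0\<close> for \<psi> in the second term makes its coefficient constant, so
    it integrates to the mass of the atom.\<close>
  also have "\<dots> = (\<integral>\<^sup>+\<psi>. predictive \<mu> f (K \<psi>) D * indicator (space S - {\<psi>\<^sub>0}) \<psi> +
      predictive \<mu> f (K \<psi>\<^sub>0) D * indicator {\<psi>\<^sub>0} \<psi> \<partial>?P)"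
    by (intro nn_integral_cong) (auto simp: eq split: split_indicator)
  also have "\<dots> = prob_no_evidence_false \<mu> f prior S \<Psi> K \<psi>\<^sub>0 D +
      predictive \<mu> f (K \<psi>\<^sub>0) D * emeasure ?P {\<psi>\<^sub>0}"
    unfolding prob_no_evidence_false_def
    by (subst nn_integral_add) (auto simp: nn_integral_cmult_indicator)
  finally show ?thesis .
qed

end

theorem theorem1:
  fixes \<mu> :: "'x measure" and f :: "'t \<Rightarrow> 'x \<Rightarrow> real" and prior :: "'t measure"
    and S :: "'p measure" and \<Psi> :: "'t \<Rightarrow> 'p" and K :: "'p \<Rightarrow> 't measure"
    and \<psi>\<^sub>0 :: 'p and R :: "'x set"
  assumes model: "bayes_model \<mu> f prior S \<Psi> K"
    and psi0: "\<psi>\<^sub>0 \<in> space S"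
    and R: "R = no_evidence_set \<mu> f prior K \<psi>\<^sub>0"
  shows
    "is_arg_max (predictive \<mu> f prior)
       (\<lambda>D. D \<in> sets \<mu> \<and> predictive \<mu> f (K \<psi>\<^sub>0) D \<le> predictive \<mu> f (K \<psi>\<^sub>0) R) R \<and>
     (emeasure (distr prior S \<Psi>) {\<psi>\<^sub>0} = 0 \<longrightarrow>
       is_arg_max (prob_no_evidence_false \<mu> f prior S \<Psi> K \<psi>\<^sub>0)
         (\<lambda>D. D \<in> sets \<mu> \<and> predictive \<mu> f (K \<psi>\<^sub>0) D \<le> predictive \<mu> f (K \<psi>\<^sub>0) R) R) \<and>
     (emeasure (distr prior S \<Psi>) {\<psi>\<^sub>0} \<noteq> 0 \<longrightarrow>
       is_arg_max (prob_no_evidence_false \<mu> f prior S \<Psi> K \<psi>\<^sub>0)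
         (\<lambda>D. D \<in> sets \<mu> \<and> predictive \<mu> f (K \<psi>\<^sub>0) D = predictive \<mu> f (K \<psi>\<^sub>0) R) R)"
proof -
  interpret bayes_model \<mu> f prior S \<Psi> K by (rule model)
  let ?P = "distr prior S \<Psi>"
  let ?F = "prob_no_evidence_false \<mu> f prior S \<Psi> K \<psi>\<^sub>0"
  \<comment> \<open>Without the quotient, \<open>R\<close> has the shape required by the
    Neyman-Pearson lemma, with \<open>p\<close> the density given \<open>\<psi>\<^sub>0\<close> and
    \<open>q\<close> the prior predictive density.\<close>
  have R_eq: "R = {x \<in> space \<mu>. predictive_density f (K \<psi>\<^sub>0) x \<le> predictive_density f prior x}"
    by (simp add: R no_evidence_set_def relative_belief_le_1_iff)
  note kernel = kernel_prob_space[OF psi0] kernel_sets[OF psi0]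
  note [measurable] = predictive_density_measurable[OF kernel]
    predictive_density_measurable[OF prior.prob_space_axioms refl]
  have R_sets: "R \<in> sets \<mu>" unfolding R_eq by measurable
  have fin: "predictive \<mu> f (K \<psi>\<^sub>0) D < \<infinity>" if "D \<in> sets \<mu>" for D
    using predictive_le_1[OF kernel that] by (rule order_le_less_trans) simp
  have max: "predictive \<mu> f prior D \<le> predictive \<mu> f prior R"
    if D: "D \<in> sets \<mu>" and le: "predictive \<mu> f (K \<psi>\<^sub>0) D \<le> predictive \<mu> f (K \<psi>\<^sub>0) R" for D
    using le fin[OF D] D unfolding predictive_def
    by (intro neyman_pearson_threshold_one[OF _ _ _ R_eq]) auto
  \<comment> \<open>A null atom makes the last term of the decomposition vanish, so
    \<open>?F\<close> agrees with the prior predictive on measurable sets.\<close>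
  have max_F_null: "?F D \<le> ?F R"
    if "emeasure ?P {\<psi>\<^sub>0} = 0" and D: "D \<in> sets \<mu>"
      and "predictive \<mu> f (K \<psi>\<^sub>0) D \<le> predictive \<mu> f (K \<psi>\<^sub>0) R" for D
    using max[OF D] that predictive_decompose[OF D psi0] predictive_decompose[OF R_sets psi0]
    by simp
  have max_F_atom: "?F D \<le> ?F R"
    if D: "D \<in> sets \<mu>" and eq: "predictive \<mu> f (K \<psi>\<^sub>0) D = predictive \<mu> f (K \<psi>\<^sub>0) R" for D
  proof -
    let ?c = "predictive \<mu> f (K \<psi>\<^sub>0) R * emeasure ?P {\<psi>\<^sub>0}"
    interpret P: prob_space ?P by (rule prior.prob_space_distr[OF Psi_measurable])
    \<comment> \<open>By \<open>eq\<close>, \<open>?c\<close> is the atom term for \<open>D\<close>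
      as well as for \<open>R\<close>; being finite, it can be cancelled from the inequality between
      the prior predictive probabilities.\<close>
    have "?c < \<infinity>"
      using fin[OF R_sets] P.emeasure_finite[of "{\<psi>\<^sub>0}"]
      by (auto simp: ennreal_mult_eq_top_iff less_top[symmetric])
    moreover have "?c + ?F D \<le> ?c + ?F R"
      using max[OF D] eq predictive_decompose[OF D psi0] predictive_decompose[OF R_sets psi0]
      by (simp add: add.commute)
    ultimately show ?thesis by (auto simp: ennreal_add_left_cancel_le)
  qed
  show ?thesis
    unfolding is_arg_max_linorder
    using R_sets max max_F_null max_F_atom by blast
qed

end
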